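(* Let $k\ge 3$ and let $P\in\mathcal{P}_3(k)$ be a finite poset. Then $\gamma_{\mathrm{os}}(P)=\gamma(\mathrm{Comp}(P^* ))$.
   Context: For a poset $P=(X,\le)$, $\mathrm{Max}(P)$ and $\mathrm{Min}(P)$ are the sets of maximal and minimal elements, and $\mathrm{Mid}(P)=X\setminus(\mathrm{Max}(P)\cup\mathrm{Min}(P))$. The height of $P$ is the maximum size (number of elements) of a chain in $P$. $\mathcal{P}_3(k)$ denotes the family of posets of height $k$ in which every element is contained in a chain of size at least $3$. The comparability graph $\mathrm{Comp}(P)$ has vertex set $X$, with $x\neq y$ adjacent iff $x<y$ or $y<x$. A dominating set of a graph is a set $S$ of vertices such that every vertex not in $S$ has a neighbor in $S$; $\gamma(G)$ is the minimum size of a dominating set of $G$. An order-sensitive dominating set of $P$ is a dominating set $D$ of $\mathrm{Comp}(P)$ such that for every $x\in\mathrm{Mid}(P)$, either $x\in D$ or there are $a,b\in D$ with $a<x<b$. $\gamma_{\mathrm{os}}(P)$ is the minimum size of an order-sensitive dominating set of $P$. The poset $P^*$: write $\mathrm{Mid}(P)=\{a_1,\dots,a_m\}$. The poset $P^*$ is obtained from $P$ by adding, for each $i$, two new elements $b_i$ and $c_i$ together with the covering relations $c_i\prec a_i\prec b_i$ (and taking the transitive closure), so its ground set is $X\cup\{b_1,\dots,b_m\}\cup\{c_1,\dots,c_m\}$. *)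

theory Defs
  imports Main
begin

section \<open>Posets\<close>

text \<open>
  A poset is a carrier \<open>X\<close> together with a reflexive relation \<open>r\<close> such that
  \<^term>\<open>partial_order_on X r\<close>; in particular \<open>r \<subseteq> X \<times> X\<close>, so every member of
  \<^term>\<open>Chains r\<close> is a subset of \<open>X\<close>.
\<close>

definition strictly_below :: "'a rel \<Rightarrow> 'a \<Rightarrow> 'a \<Rightarrow> bool" where
  "strictly_below r x y \<longleftrightarrow> (x, y) \<in> r \<and> x \<noteq> y"

definition Max_elts :: "'a set \<Rightarrow> 'a rel \<Rightarrow> 'a set" where
  "Max_elts X r = {x \<in> X. \<not> (\<exists>y\<in>X. strictly_below r x y)}"

definition Min_elts :: "'a set \<Rightarrow> 'a rel \<Rightarrow> 'a set" where
  "Min_elts X r = {x \<in> X. \<not> (\<exists>y\<in>X. strictly_below r y x)}"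

definition Mid_elts :: "'a set \<Rightarrow> 'a rel \<Rightarrow> 'a set" where
  "Mid_elts X r = X - (Max_elts X r \<union> Min_elts X r)"

text \<open>
  The height is a relation rather than a function, so that it is meaningful (namely absent) for
  posets whose chains are unbounded in size.
\<close>

definition has_height :: "'a rel \<Rightarrow> nat \<Rightarrow> bool" where
  "has_height r k \<longleftrightarrow>
     (\<exists>C\<in>Chains r. finite C \<and> card C = k) \<and> (\<forall>C\<in>Chains r. finite C \<and> card C \<le> k)"

definition P3 :: "nat \<Rightarrow> ('a set \<times> 'a rel) set" where
  "P3 k = {(X, r). partial_order_on X r \<and> has_height r k \<and>
                   (\<forall>x\<in>X. \<exists>C\<in>Chains r. x \<in> C \<and> 3 \<le> card C)}"


section \<open>Graphs and domination\<close>

text \<open>A graph is a pair of a vertex set and a set of two-element edges.\<close>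

type_synonym 'v graph = "'v set \<times> 'v set set"

definition Comp :: "'a set \<Rightarrow> 'a rel \<Rightarrow> 'a graph" where
  "Comp X r = (X, {{x, y} |x y. x \<in> X \<and> y \<in> X \<and> x \<noteq> y \<and>
                                (strictly_below r x y \<or> strictly_below r y x)})"

definition dominating_set :: "'v graph \<Rightarrow> 'v set \<Rightarrow> bool" where
  "dominating_set G S \<longleftrightarrow> S \<subseteq> fst G \<and> (\<forall>v \<in> fst G - S. \<exists>u\<in>S. {v, u} \<in> snd G)"

definition domination_number :: "'v graph \<Rightarrow> nat" where
  "domination_number G = (LEAST n. \<exists>S. dominating_set G S \<and> finite S \<and> card S = n)"

definition os_dominating_set :: "'a set \<Rightarrow> 'a rel \<Rightarrow> 'a set \<Rightarrow> bool" where
  "os_dominating_set X r D \<longleftrightarrow>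
     dominating_set (Comp X r) D \<and>
     (\<forall>x \<in> Mid_elts X r. x \<in> D \<or>
        (\<exists>a\<in>D. \<exists>b\<in>D. strictly_below r a x \<and> strictly_below r x b))"

definition os_domination_number :: "'a set \<Rightarrow> 'a rel \<Rightarrow> nat" where
  "os_domination_number X r =
     (LEAST n. \<exists>D. os_dominating_set X r D \<and> finite D \<and> card D = n)"


section \<open>The poset \<open>P\<^sup>*\<close>\<close>

text \<open>
  \<open>Orig x\<close> is the copy of \<open>x \<in> X\<close>; for \<open>a\<close> a middle element, \<open>Above a\<close> and \<open>Below a\<close> are the new
  elements \<open>b\<close> and \<open>c\<close> placed directly above and directly below \<open>a\<close>.
\<close>

datatype 'a star = Orig 'a | Above 'a | Below 'a

definition star_carrier :: "'a set \<Rightarrow> 'a rel \<Rightarrow> 'a star set" where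
  "star_carrier X r = Orig ` X \<union> Above ` Mid_elts X r \<union> Below ` Mid_elts X r"

text \<open>The identity part supplies reflexivity at the new elements.\<close>

definition star_rel :: "'a set \<Rightarrow> 'a rel \<Rightarrow> 'a star rel" where
  "star_rel X r =
     (Id_on (star_carrier X r) \<union> map_prod Orig Orig ` r
        \<union> {(Below a, Orig a) |a. a \<in> Mid_elts X r}
        \<union> {(Orig a, Above a) |a. a \<in> Mid_elts X r})\<^sup>+"

end

theory Submission
  imports Defs
begin

text \<open>
  An order-sensitive dominating set of \<open>P\<close> also dominates every \<open>b\<^sub>i\<close> and \<open>c\<^sub>i\<close>, since it contains
  \<open>a\<^sub>i\<close> or elements on both sides of \<open>a\<^sub>i\<close>. Conversely, the closed neighbourhood of \<open>a\<^sub>i\<close> in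
  \<open>Comp(P\<^sup>*)\<close> contains those of \<open>b\<^sub>i\<close> and \<open>c\<^sub>i\<close>, so collapsing \<open>b\<^sub>i\<close> and \<open>c\<^sub>i\<close> to \<open>a\<^sub>i\<close> turns a
  dominating set of \<open>Comp(P\<^sup>*)\<close> into one inside \<open>X\<close>; if it misses \<open>a\<^sub>i\<close>, then it can dominate
  \<open>b\<^sub>i\<close> only from below \<open>a\<^sub>i\<close> and \<open>c\<^sub>i\<close> only from above \<open>a\<^sub>i\<close>.
\<close>

fun base :: "'a star \<Rightarrow> 'a" where
  "base (Orig x) = x"
| "base (Above x) = x"
| "base (Below x) = x"

lemma Mid_elts_subset: "Mid_elts X r \<subseteq> X"
  by (auto simp: Mid_elts_def)

lemma base_star_carrier: "u \<in> star_carrier X r \<Longrightarrow> base u \<in> X"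
  using Mid_elts_subset by (fastforce simp: star_carrier_def)

lemma Comp_edge_iff:
  "{v, u} \<in> snd (Comp X r) \<longleftrightarrow>
     v \<in> X \<and> u \<in> X \<and> u \<noteq> v \<and> ((u, v) \<in> r \<or> (v, u) \<in> r)"
  unfolding Comp_def strictly_below_def by (simp add: doubleton_eq_iff) blast

text \<open>The distinctness required of an edge is automatic, because \<open>u\<close> lies in
  \<open>S\<close> and \<open>v\<close> does not.\<close>

lemma dominating_set_Comp_iff:
  "dominating_set (Comp X r) S \<longleftrightarrow>
     S \<subseteq> X \<and> (\<forall>v\<in>X - S. \<exists>u\<in>S. (u, v) \<in> r \<or> (v, u) \<in> r)"
proof -
  have "fst (Comp X r) = X" by (simp add: Comp_def)
  then show ?thesis
    unfolding dominating_set_def Comp_edge_iff by auto blast+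
qed

text \<open>Each generating pair has this property, and transitivity of \<open>r\<close> carries it
  along the closure. It records that \<open>base\<close> is monotone, that each
  \<open>Above a\<close> is maximal and that each \<open>Below a\<close> is minimal.\<close>

lemma star_relD:
  assumes "refl_on X r" "trans r" "(u, v) \<in> star_rel X r"
  shows "u = v \<or> (base u, base v) \<in> r \<and> u \<notin> range Above \<and> v \<notin> range Below"
  using assms(3) unfolding star_rel_def
proof (induction rule: trancl_induct)
  case (base y)
  then show ?case
    using assms(1) Mid_elts_subset[of X r] by (auto dest: refl_onD)
next
  case (step y z)
  have "y = z \<or> (base y, base z) \<in> r \<and> y \<notin> range Above \<and> z \<notin> range Below"
    using step.hyps(2) assms(1) Mid_elts_subset[of X r] by (auto dest: refl_onD)
  with step.IH show ?case
    using assms(2) by (auto dest: transD)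
qed

lemma star_rel_Orig_Orig: "(x, y) \<in> r \<Longrightarrow> (Orig x, Orig y) \<in> star_rel X r"
  unfolding star_rel_def by (rule r_into_trancl) (force simp: map_prod_def)

lemma star_rel_Orig_Above:
  assumes "(x, a) \<in> r" "a \<in> Mid_elts X r"
  shows "(Orig x, Above a) \<in> star_rel X r"
  using star_rel_Orig_Orig[OF assms(1), of X] assms(2)
  unfolding star_rel_def by (auto intro: trancl_into_trancl)

lemma star_rel_Below_Orig:
  assumes "(a, x) \<in> r" "a \<in> Mid_elts X r"
  shows "(Below a, Orig x) \<in> star_rel X r"
  using star_rel_Orig_Orig[OF assms(1), of X] assms(2)
  unfolding star_rel_def by (auto intro: trancl_into_trancl2)

lemma dominating_set_Orig_image:
  assumes "refl_on X r" "os_dominating_set X r D"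
  shows "dominating_set (Comp (star_carrier X r) (star_rel X r)) (Orig ` D)"
proof -
  let ?R = "star_rel X r"
  have D: "D \<subseteq> X" "\<And>x. x \<in> X - D \<Longrightarrow> \<exists>u\<in>D. (u, x) \<in> r \<or> (x, u) \<in> r"
    using assms(2) by (auto simp: os_dominating_set_def dominating_set_Comp_iff)
  \<comment> \<open>The bounds are non-strict so that \<open>u = a\<close> covers the case
    \<open>a \<in> D\<close>.\<close>
  have mid: "(\<exists>u\<in>D. (u, a) \<in> r) \<and> (\<exists>u\<in>D. (a, u) \<in> r)" if "a \<in> Mid_elts X r" for a
    using assms that Mid_elts_subset[of X r]
    unfolding os_dominating_set_def strictly_below_def by (meson refl_onD subsetD)
  have "\<exists>u\<in>Orig ` D. (u, v) \<in> ?R \<or> (v, u) \<in> ?R"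
    if "v \<in> star_carrier X r - Orig ` D" for v
  proof (cases v)
    case (Orig x)
    with that have "x \<in> X - D" by (auto simp: star_carrier_def)
    with D(2) Orig show ?thesis by (blast intro: star_rel_Orig_Orig)
  next
    case (Above a)
    with that have "a \<in> Mid_elts X r" by (auto simp: star_carrier_def)
    with mid Above show ?thesis by (blast intro: star_rel_Orig_Above)
  next
    case (Below a)
    with that have "a \<in> Mid_elts X r" by (auto simp: star_carrier_def)
    with mid Below show ?thesis by (blast intro: star_rel_Below_Orig)
  qed
  moreover have "Orig ` D \<subseteq> star_carrier X r"
    using D(1) by (auto simp: star_carrier_def)
  ultimately show ?thesis by (simp add: dominating_set_Comp_iff)
qed

lemma os_dominating_set_base_image:
  assumes "refl_on X r" "trans r"
    and "dominating_set (Comp (star_carrier X r) (star_rel X r)) S"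
  shows "os_dominating_set X r (base ` S)"
proof -
  let ?R = "star_rel X r"
  have S: "S \<subseteq> star_carrier X r"
    using assms(3) by (simp add: dominating_set_Comp_iff)
  have dom: "\<exists>u\<in>S. (u, v) \<in> ?R \<or> (v, u) \<in> ?R"
    if "v \<in> star_carrier X r" "base v \<notin> base ` S" for v
    using assms(3) that by (auto simp: dominating_set_Comp_iff)
  note R = star_relD[OF assms(1,2)]
  have "\<exists>d\<in>base ` S. (d, x) \<in> r \<or> (x, d) \<in> r" if x: "x \<in> X - base ` S" for x
  proof -
    obtain u where u: "u \<in> S" "(u, Orig x) \<in> ?R \<or> (Orig x, u) \<in> ?R"
      using dom[of "Orig x"] x by (auto simp: star_carrier_def)
    have "base u \<noteq> x" using u(1) x by auto
    then have "(base u, x) \<in> r \<or> (x, base u) \<in> r"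
      using u(2) by (auto dest!: R)
    with u(1) show ?thesis by blast
  qed
  moreover have "base ` S \<subseteq> X"
    using S base_star_carrier by blast
  moreover have "\<exists>a\<in>base ` S. \<exists>b\<in>base ` S. strictly_below r a x \<and> strictly_below r x b"
    if x: "x \<in> Mid_elts X r" "x \<notin> base ` S" for x
  proof -
    obtain u where u: "u \<in> S" "(u, Above x) \<in> ?R \<or> (Above x, u) \<in> ?R"
      using dom[of "Above x"] x by (auto simp: star_carrier_def)
    obtain w where w: "w \<in> S" "(w, Below x) \<in> ?R \<or> (Below x, w) \<in> ?R"
      using dom[of "Below x"] x by (auto simp: star_carrier_def)
    have ne: "base u \<noteq> x" "base w \<noteq> x" using u(1) w(1) x(2) by auto
    \<comment> \<open>By \<open>star_relD\<close>, \<open>Above x\<close> cannot be the lower end of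
      a nontrivial pair, nor \<open>Below x\<close> the upper end; \<open>ne\<close> excludes
      trivial pairs.\<close>
    then have "(base u, x) \<in> r" "(x, base w) \<in> r"
      using u(2) w(2) by (auto dest!: R)
    with u(1) w(1) ne show ?thesis
      unfolding strictly_below_def by blast
  qed
  ultimately show ?thesis
    unfolding os_dominating_set_def dominating_set_Comp_iff by blast
qed

theorem lemma5:
  fixes X :: "'a set" and r :: "'a rel" and k :: nat
  assumes "3 \<le> k"
    and "finite X"
    and "(X, r) \<in> P3 k"
  shows "os_domination_number X r
           = domination_number (Comp (star_carrier X r) (star_rel X r))"
proof (rule antisym)
  let ?G = "Comp (star_carrier X r) (star_rel X r)"
  have r: "refl_on X r" "trans r"
    using assms(3) by (auto simp: P3_def partial_order_on_def preorder_on_def)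
  \<comment> \<open>The whole of \<open>X\<close> is a witness, so the \<open>LEAST\<close> is
    attained.\<close>
  have os_ex: "\<exists>n D. os_dominating_set X r D \<and> finite D \<and> card D = n"
    using assms(2) Mid_elts_subset[of X r]
    by (auto simp: os_dominating_set_def dominating_set_Comp_iff intro!: exI[of _ X])
  obtain D where D: "os_dominating_set X r D" "finite D" "card D = os_domination_number X r"
    using LeastI_ex[OF os_ex] unfolding os_domination_number_def by blast
  have "dominating_set ?G (Orig ` D)" and "finite (Orig ` D)" and "card (Orig ` D) = card D"
    using dominating_set_Orig_image[OF r(1) D(1)] D(2) by (auto intro: card_image injI inj_onI)
  \<comment> \<open>This both bounds the domination number and shows that its \<open>LEAST\<close>
    is attained.\<close>
  then have dom: "\<exists>S. dominating_set ?G S \<and> finite S \<and> card S = card D"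
    by blast
  show "domination_number ?G \<le> os_domination_number X r"
    unfolding D(3)[symmetric] domination_number_def using dom by (rule Least_le)
  obtain S where S: "dominating_set ?G S" "finite S" "card S = domination_number ?G"
    using LeastI[where P = "\<lambda>n. \<exists>S. dominating_set ?G S \<and> finite S \<and> card S = n", OF dom]
    unfolding domination_number_def by blast
  have "os_domination_number X r \<le> card (base ` S)"
    unfolding os_domination_number_def
    using os_dominating_set_base_image[OF r S(1)] S(2) by (blast intro: Least_le)
  \<comment> \<open>Unlike \<open>Orig\<close>, \<open>base\<close> can merge elements, so
    cardinality may drop; an inequality suffices.\<close>
  also have "\<dots> \<le> domination_number ?G"
    using card_image_le[OF S(2)] S(3) by simp
  finally show "os_domination_number X r \<le> domination_number ?G" .
qed

end
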